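(* Let $\Xi=(\xi_{ij})$ be a real symmetric $n\times n$ matrix with zero diagonal and largest eigenvalue $\lambda_\Xi$. For $p>1$ define on $\mathbb{R}^{2n}$ $$U_d(c,s)=\sum_{j=1}^n\left(\frac14(c_j^2+s_j^2)^2-\frac p2(c_j^2-s_j^2)+\frac12(c_j^2+s_j^2)\right)-\frac12c^T\Xi c-\frac12s^T\Xi s.$$ There is an admissible threshold $\alpha_*>0$ for $(\beta,S)=(1,\Xi)$ (see context) such that whenever $p>\max\{\alpha_*^2,\lambda_\Xi\}$, if $(c,0)$ is a global minimum point of $U_d$, then $\operatorname{sgn}(c)$ minimizes the Ising energy $E(v)=-\frac12v^T\Xi v$ over $v\in\{-1,1\}^n$.
   Context: $\operatorname{sgn}$ is the componentwise sign. For $\beta>0$ and $S$ real symmetric with zero diagonal, a constant $\alpha_*>0$ is an admissible threshold for $(\beta,S)$ if for every $\alpha>\alpha_*$ the function $U(x)=\sum_{i=1}^n\frac14x_i^4+\frac{\beta-\alpha^2}{2}x^Tx-\frac12x^TSx$ on $\mathbb{R}^n$ has the properties: the signum vectors of its local minimum points form the set $\{-1,1\}^n$, and the signum vector of every global minimum point minimizes $-\frac12v^TSv$ over $\{-1,1\}^n$. The function $U_d$ is the potential of the coherent Ising machine $\dot c_j=-\partial U_d/\partial c_j$, $\dot s_j=-\partial U_d/\partial s_j$. *)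

theory Defs
  imports "HOL-Analysis.Analysis"
begin

definition sgn_vec :: "real ^ 'n \<Rightarrow> real ^ 'n" where
  "sgn_vec x = (\<chi> i. sgn (x $ i))"

definition sign_vectors :: "(real ^ 'n) set" where
  "sign_vectors = {v. \<forall>i. v $ i \<in> {-1, 1}}"

definition ising_energy :: "real ^ 'n ^ 'n \<Rightarrow> real ^ 'n \<Rightarrow> real" where
  "ising_energy S v = - (1/2) * (v \<bullet> (S *v v))"

definition is_local_min :: "('a::metric_space \<Rightarrow> real) \<Rightarrow> 'a \<Rightarrow> bool" where
  "is_local_min f x \<longleftrightarrow> (\<exists>e>0. \<forall>y\<in>ball x e. f x \<le> f y)"

definition is_global_min :: "('a \<Rightarrow> real) \<Rightarrow> 'a \<Rightarrow> bool" where
  "is_global_min f x \<longleftrightarrow> is_arg_min f (\<lambda>_. True) x"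

definition eigenvalues :: "real ^ 'n ^ 'n \<Rightarrow> real set" where
  "eigenvalues A = {l. \<exists>v. v \<noteq> 0 \<and> A *v v = l *\<^sub>R v}"

lemma symmetric_inner:
  fixes A :: "real ^ 'n ^ 'n"
  assumes "transpose A = A"
  shows "x \<bullet> (A *v y) = (A *v x) \<bullet> y"
  by (metis assms dot_lmul_matrix transpose_matrix_vector)

text \<open>The next two facts make the maximum in \<open>largest_eigenvalue\<close> below meaningful for
  symmetric matrices; their eigenvalues are all real, so none are missed by
  \<open>eigenvalues\<close>. For other matrices the maximum may be taken over the empty set.\<close>

lemma finite_eigenvalues:
  fixes A :: "real ^ 'n ^ 'n"
  assumes "transpose A = A"
  shows "finite (eigenvalues A)"
proof -
  have "\<forall>l\<in>eigenvalues A. \<exists>v. v \<noteq> 0 \<and> A *v v = l *\<^sub>R v"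
    by (simp add: eigenvalues_def)
  then obtain v where v: "\<And>l. l \<in> eigenvalues A \<Longrightarrow> v l \<noteq> 0 \<and> A *v v l = l *\<^sub>R v l"
    by (auto dest!: bchoice)
  have orth: "v l \<bullet> v m = 0" if "l \<in> eigenvalues A" "m \<in> eigenvalues A" "l \<noteq> m" for l m
  proof -
    have "m * (v l \<bullet> v m) = l * (v l \<bullet> v m)"
      using symmetric_inner[OF assms, of "v l" "v m"] v[OF that(1)] v[OF that(2)] by simp
    with that show ?thesis by simp
  qed
  have "inj_on v (eigenvalues A)"
    by (rule inj_onI) (metis orth v inner_eq_zero_iff)
  moreover have "independent (v ` eigenvalues A)"
  proof (rule pairwise_orthogonal_independent)
    show "pairwise orthogonal (v ` eigenvalues A)"
      using orth by (fastforce simp: pairwise_def orthogonal_def)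
    show "0 \<notin> v ` eigenvalues A" using v by auto
  qed
  ultimately show ?thesis
    using finite_imageD independent_imp_finite by blast
qed

lemma eigenvalues_nonempty:
  fixes A :: "real ^ 'n ^ 'n"
  assumes "transpose A = A"
  shows "eigenvalues A \<noteq> {}"
proof -
  let ?q = "\<lambda>x. x \<bullet> (A *v x)"
  have "continuous_on (sphere 0 1) ?q"
    by (intro continuous_intros matrix_vector_mult_linear_continuous_on)
  moreover have "sphere 0 1 \<noteq> ({} :: (real ^ 'n) set)" by simp
  ultimately obtain x where x: "x \<in> sphere 0 1" "\<And>y. y \<in> sphere 0 1 \<Longrightarrow> ?q y \<le> ?q x"
    using continuous_attains_sup[of "sphere 0 1" ?q] by auto
  define l where "l = ?q x"
  have nonneg: "0 \<le> l * (y \<bullet> y) - ?q y" for y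
  proof (cases "y = 0")
    case False
    have "?q ((1 / norm y) *\<^sub>R y) \<le> l"
      using False unfolding l_def by (intro x(2)) simp
    then have "?q y / (norm y)^2 \<le> l"
      by (simp add: matrix_vector_mult_scaleR power2_eq_square)
    with False show ?thesis
      by (simp add: divide_le_eq power2_norm_eq_inner)
  qed simp
  have xx: "x \<bullet> x = 1" using x(1) by (simp add: norm_eq_1)
  define w where "w = l *\<^sub>R x - A *v x"
  have "w \<bullet> w = 0"
  proof (rule ccontr)
    assume "w \<bullet> w \<noteq> 0"
    then have pos: "w \<bullet> w > 0" by (simp add: inner_gt_zero_iff)
    define b where "b = l * (w \<bullet> w) - ?q w"
    have b: "b \<ge> 0" unfolding b_def by (rule nonneg)
    have expand: "l * ((x + t *\<^sub>R w) \<bullet> (x + t *\<^sub>R w)) - ?q (x + t *\<^sub>R w) = 2 * t * (w \<bullet> w) + t^2 * b" for t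
    proof -
      have s: "x \<bullet> (A *v w) = w \<bullet> (A *v x)"
        using symmetric_inner[OF assms, of x w] by (simp add: inner_commute)
      have ww: "w \<bullet> w = l * (w \<bullet> x) - w \<bullet> (A *v x)"
        by (subst (2) w_def) (simp add: inner_diff_right)
      have "l * ((x + t *\<^sub>R w) \<bullet> (x + t *\<^sub>R w)) - ?q (x + t *\<^sub>R w)
        = (l * (x \<bullet> x) - ?q x) + 2 * t * (l * (w \<bullet> x) - w \<bullet> (A *v x)) + t^2 * (l * (w \<bullet> w) - ?q w)"
        by (simp add: matrix_vector_right_distrib matrix_vector_mult_scaleR inner_add_left
            inner_add_right s inner_commute[of x w] algebra_simps power2_eq_square)
      then show ?thesis using xx by (simp add: l_def[symmetric] ww[symmetric] b_def)
    qed
    define t where "t = - (w \<bullet> w) / (b + 1)"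
    have tb: "t * (b + 1) = - (w \<bullet> w)" "t < 0" using b pos by (auto simp: t_def divide_neg_pos)
    have "2 * (w \<bullet> w) + t * b = w \<bullet> w - t" using tb(1) by (simp add: algebra_simps)
    then have "2 * (w \<bullet> w) + t * b > 0" using pos tb(2) by linarith
    then have "t * (2 * (w \<bullet> w) + t * b) < 0" using tb(2) by (rule mult_neg_pos[rotated])
    moreover have "0 \<le> 2 * t * (w \<bullet> w) + t^2 * b" using nonneg[of "x + t *\<^sub>R w"] expand by simp
    ultimately show False by (simp add: algebra_simps power2_eq_square)
  qed
  then have "A *v x = l *\<^sub>R x" by (simp add: w_def)
  moreover have "x \<noteq> 0" using xx by auto
  ultimately show ?thesis unfolding eigenvalues_def by blast
qed

definition largest_eigenvalue :: "real ^ 'n ^ 'n \<Rightarrow> real" where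
  "largest_eigenvalue A = Max (eigenvalues A)"

definition cim_U :: "real \<Rightarrow> real ^ 'n ^ 'n \<Rightarrow> real \<Rightarrow> real ^ 'n \<Rightarrow> real" where
  "cim_U \<beta> S \<alpha> x =
     (\<Sum>i\<in>UNIV. 1/4 * (x $ i)^4) + (\<beta> - \<alpha>^2) / 2 * (x \<bullet> x) - 1/2 * (x \<bullet> (S *v x))"

definition admissible_threshold :: "real \<Rightarrow> real ^ 'n ^ 'n \<Rightarrow> real \<Rightarrow> bool" where
  "admissible_threshold \<beta> S \<alpha>\<^sub>0 \<longleftrightarrow> \<alpha>\<^sub>0 > 0 \<and>
     (\<forall>\<alpha>>\<alpha>\<^sub>0.
        sgn_vec ` {x. is_local_min (cim_U \<beta> S \<alpha>) x} = sign_vectors \<and>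
        (\<forall>x. is_global_min (cim_U \<beta> S \<alpha>) x \<longrightarrow>
             is_arg_min (ising_energy S) (\<lambda>v. v \<in> sign_vectors) (sgn_vec x)))"

definition cim_U_d :: "real ^ 'n ^ 'n \<Rightarrow> real \<Rightarrow> (real ^ 'n) \<times> (real ^ 'n) \<Rightarrow> real" where
  "cim_U_d \<Xi> p = (\<lambda>(c, s).
     (\<Sum>j\<in>UNIV. 1/4 * ((c $ j)^2 + (s $ j)^2)^2 - p/2 * ((c $ j)^2 - (s $ j)^2)
        + 1/2 * ((c $ j)^2 + (s $ j)^2))
     - 1/2 * (c \<bullet> (\<Xi> *v c)) - 1/2 * (s \<bullet> (\<Xi> *v s)))"

end

theory Submission
  imports Defs
begin

text \<open>
  Put \<open>a = \<alpha>\<^sup>2 - \<beta>\<close> and \<open>x = sqrt a y\<close>. Up to a constant and the factor \<open>a\<^sup>2\<close>, the potential becomes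
  the sum of the double wells \<open>(y\<^sub>i\<^sup>2 - 1)\<^sup>2 / 4\<close> perturbed by \<open>1/a\<close> times the Ising energy of \<open>y\<close>. For
  large \<open>a\<close> the perturbation is too weak to remove the minimum of the wells near a sign vector \<open>v\<close>,
  and the value at a point with signs \<open>v\<close> is at least \<open>E(v) / a - O(1 / a\<^sup>2)\<close>; since \<open>E\<close> takes finitely
  many values on sign vectors, the term of order \<open>1/a\<close> decides which orthants can contain a global
  minimum. A local minimum has no vanishing coordinate, because in such a coordinate the potential
  is an inverted parabola near 0 plus a linear term.
  Finally, \<open>U\<^sub>d (c, 0)\<close> is the potential at \<open>c\<close> for \<open>\<alpha> = sqrt p\<close> and \<open>\<beta> = 1\<close>.
\<close>

section \<open>Sign vectors and gaps between finitely many values\<close>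

lemma finite_sign_vectors: "finite (sign_vectors :: (real ^ 'n) set)"
proof -
  have "vec_nth ` (sign_vectors :: (real ^ 'n) set) \<subseteq> Pi\<^sub>E UNIV (\<lambda>_. {-1, 1})"
    by (auto simp: sign_vectors_def)
  moreover have "finite (Pi\<^sub>E (UNIV :: 'n set) (\<lambda>_. {-1, 1 :: real}))"
    by (intro finite_PiE) auto
  ultimately have "finite (vec_nth ` (sign_vectors :: (real ^ 'n) set))"
    by (rule finite_subset)
  then show ?thesis
    by (rule finite_imageD) (simp add: inj_on_def vec_nth_inject)
qed

lemma sign_vector_nth:
  assumes "v \<in> sign_vectors"
  shows "v $ i = -1 \<or> v $ i = 1" "\<bar>v $ i\<bar> = 1" "(v $ i)\<^sup>2 = 1"
proof -
  have "v $ i \<in> {-1, 1}"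
    using assms by (simp add: sign_vectors_def)
  then show "v $ i = -1 \<or> v $ i = 1" "\<bar>v $ i\<bar> = 1" "(v $ i)\<^sup>2 = 1"
    by auto
qed

lemma sgn_vec_in_sign_vectors_iff: "sgn_vec x \<in> sign_vectors \<longleftrightarrow> (\<forall>i. x $ i \<noteq> 0)"
  by (simp add: sgn_vec_def sign_vectors_def sgn_if) (metis less_irrefl)

lemma sgn_vec_scaleR:
  assumes "r > 0"
  shows "sgn_vec (r *\<^sub>R x) = sgn_vec x"
  using assms by (simp add: sgn_vec_def sgn_mult)

lemma finite_gap:
  fixes f :: "'a \<Rightarrow> real"
  assumes "finite A"
  obtains g where "g > 0" "\<And>x y. x \<in> A \<Longrightarrow> y \<in> A \<Longrightarrow> f x < f y \<Longrightarrow> f x + g \<le> f y"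
proof
  define D where "D = {d \<in> (\<lambda>(x, y). f y - f x) ` (A \<times> A). d > 0}"
  \<comment> \<open>The element 1 keeps \<open>Min\<close> meaningful when \<open>f\<close> is
    constant on \<open>A\<close> and \<open>D\<close> is empty.\<close>
  have fin: "finite (insert 1 D)"
    using assms by (simp add: D_def)
  show "Min (insert 1 D) > 0"
    using fin by (subst Min_gr_iff) (auto simp: D_def)
  show "f x + Min (insert 1 D) \<le> f y" if "x \<in> A" "y \<in> A" "f x < f y" for x y
  proof -
    have "f y - f x \<in> D"
      using that by (force simp: D_def)
    then have "Min (insert 1 D) \<le> f y - f x"
      using fin by (intro Min_le) auto
    then show ?thesis by simp
  qed
qed

section \<open>Sup-norm bounds for the quadratic form\<close>

definition abs_sum :: "real ^ 'n ^ 'n \<Rightarrow> real" where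
  "abs_sum S = (\<Sum>i\<in>UNIV. \<Sum>j\<in>UNIV. \<bar>S $ i $ j\<bar>)"

lemma abs_sum_nonneg: "abs_sum S \<ge> 0"
  by (simp add: abs_sum_def sum_nonneg)

lemma bilinear_bound:
  fixes S :: "real ^ 'n ^ 'n"
  assumes "\<And>i. \<bar>y $ i\<bar> \<le> A" "\<And>i. \<bar>z $ i\<bar> \<le> B"
  shows "\<bar>y \<bullet> (S *v z)\<bar> \<le> abs_sum S * A * B"
proof -
  \<comment> \<open>Index types are nonempty, so any index will do.\<close>
  have A: "A \<ge> 0" using assms(1)[of undefined] by linarith
  have "y \<bullet> (S *v z) = (\<Sum>i\<in>UNIV. \<Sum>j\<in>UNIV. y $ i * (S $ i $ j * z $ j))"
    by (simp add: inner_vec_def matrix_vector_mult_def sum_distrib_left)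
  also have "\<bar>\<dots>\<bar> \<le> (\<Sum>i\<in>UNIV. \<Sum>j\<in>UNIV. \<bar>y $ i * (S $ i $ j * z $ j)\<bar>)"
    by (intro order_trans[OF sum_abs] sum_mono sum_abs)
  also have "\<dots> \<le> (\<Sum>i\<in>UNIV. \<Sum>j\<in>UNIV. A * (\<bar>S $ i $ j\<bar> * B))"
    using assms A by (intro sum_mono) (auto simp: abs_mult intro!: mult_mono)
  also have "\<dots> = abs_sum S * A * B"
    by (simp add: abs_sum_def sum_distrib_left sum_distrib_right mult_ac)
  finally show ?thesis .
qed

lemma ising_energy_bound:
  assumes "\<And>i. \<bar>y $ i\<bar> \<le> A"
  shows "\<bar>ising_energy S y\<bar> \<le> abs_sum S * A\<^sup>2 / 2"
  using bilinear_bound[of y A y A S] assms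
  by (simp add: ising_energy_def abs_mult power2_eq_square)

lemma ising_energy_diff:
  assumes v: "v \<in> sign_vectors" and m: "\<And>i. \<bar>y $ i - v $ i\<bar> \<le> m"
  shows "\<bar>ising_energy S y - ising_energy S v\<bar> \<le> abs_sum S * (2 * m + m\<^sup>2) / 2"
proof -
  have y: "\<bar>y $ i\<bar> \<le> 1 + m" for i
    using m[of i] sign_vector_nth(2)[OF v, of i] by linarith
  \<comment> \<open>Replacing one argument at a time leaves a factor \<open>y - v\<close>, of size
    at most \<open>m\<close>, in each term.\<close>
  have "y \<bullet> (S *v y) - v \<bullet> (S *v v) = (y - v) \<bullet> (S *v y) + v \<bullet> (S *v (y - v))"
    by (simp add: inner_diff_left inner_diff_right matrix_vector_mult_diff_distrib)
  moreover have "\<bar>(y - v) \<bullet> (S *v y)\<bar> \<le> abs_sum S * m * (1 + m)"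
    using m y by (intro bilinear_bound) auto
  moreover have "\<bar>v \<bullet> (S *v (y - v))\<bar> \<le> abs_sum S * 1 * m"
    using m sign_vector_nth(2)[OF v] by (intro bilinear_bound) auto
  ultimately have "\<bar>y \<bullet> (S *v y) - v \<bullet> (S *v v)\<bar> \<le> abs_sum S * (2 * m + m\<^sup>2)"
    by (simp add: algebra_simps power2_eq_square)
  then show ?thesis
    unfolding ising_energy_def by linarith
qed

section \<open>The rescaled potential\<close>

definition well_energy :: "real \<Rightarrow> real ^ 'n ^ 'n \<Rightarrow> real ^ 'n \<Rightarrow> real" where
  "well_energy \<epsilon> S y = (\<Sum>i\<in>UNIV. 1/4 * ((y $ i)\<^sup>2 - 1)\<^sup>2) + \<epsilon> * ising_energy S y"

text \<open>Under x = sqrt(a) y the quartic and quadratic terms both scale by a^2 and combine by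
  completing the square, while the energy scales only by a; hence the weight 1/a. Comparisons of
  values are unaffected by the constant and the positive factor.\<close>

lemma cim_U_scaleR:
  fixes S :: "real ^ 'n ^ 'n"
  assumes "\<alpha>\<^sup>2 - \<beta> = a" "a > 0"
  shows "cim_U \<beta> S \<alpha> (sqrt a *\<^sub>R y) = a\<^sup>2 * (well_energy (1 / a) S y - CARD('n) / 4)"
proof -
  have r: "sqrt a * sqrt a = a" "(sqrt a)^4 = a\<^sup>2"
    using assms(2) by (simp_all add: power4_eq_xxxx power2_eq_square)
  have "(\<Sum>i\<in>UNIV. 1/4 * ((sqrt a *\<^sub>R y) $ i)^4) + (\<beta> - \<alpha>\<^sup>2) / 2 * ((sqrt a *\<^sub>R y) \<bullet> (sqrt a *\<^sub>R y))
      = (\<Sum>i\<in>UNIV. a\<^sup>2 * (1/4 * ((y $ i)\<^sup>2 - 1)\<^sup>2 - 1/4))" (is "?lhs = _")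
    unfolding inner_vec_def sum_distrib_left sum.distrib[symmetric]
  proof (rule sum.cong)
    fix i
    have b: "\<beta> - \<alpha>\<^sup>2 = - a" using assms(1) by simp
    have "(sqrt a * y $ i) \<bullet> (sqrt a * y $ i) = a * (y $ i)\<^sup>2"
      using assms(2) by (simp add: power2_eq_square mult_ac)
    then show "1/4 * ((sqrt a *\<^sub>R y) $ i)^4 + (\<beta> - \<alpha>\<^sup>2) / 2 * ((sqrt a *\<^sub>R y) $ i \<bullet> (sqrt a *\<^sub>R y) $ i)
      = a\<^sup>2 * (1/4 * ((y $ i)\<^sup>2 - 1)\<^sup>2 - 1/4)"
      by (simp add: b power_mult_distrib r(2)) (simp add: field_simps power2_eq_square power4_eq_xxxx)
  qed simp
  also have "\<dots> = a\<^sup>2 * ((\<Sum>i\<in>UNIV. 1/4 * ((y $ i)\<^sup>2 - 1)\<^sup>2) - CARD('n) / 4)"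
    by (simp only: sum_distrib_left[symmetric] sum_subtractf) simp
  finally have "?lhs = \<dots>" .
  moreover have "cim_U \<beta> S \<alpha> (sqrt a *\<^sub>R y) = ?lhs + ising_energy S (sqrt a *\<^sub>R y)"
    by (simp add: cim_U_def ising_energy_def)
  moreover have "ising_energy S (sqrt a *\<^sub>R y) = a * ising_energy S y"
    using assms(2) by (simp add: ising_energy_def matrix_vector_mult_scaleR mult.assoc[symmetric])
  moreover have "a\<^sup>2 * (1 / a * ising_energy S y) = a * ising_energy S y"
    using assms(2) by (simp add: power2_eq_square)
  ultimately show ?thesis
    unfolding well_energy_def by (simp only: distrib_left right_diff_distrib)
qed

section \<open>A local minimum in every orthant\<close>

lemma well_energy_sign_vector:
  assumes "v \<in> sign_vectors"
  shows "well_energy \<epsilon> S v = \<epsilon> * ising_energy S v"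
  by (simp add: well_energy_def sign_vector_nth(3)[OF assms])

lemma well_energy_ge_coordinate:
  "well_energy \<epsilon> S y \<ge> 1/4 * ((y $ i)\<^sup>2 - 1)\<^sup>2 + \<epsilon> * ising_energy S y"
  unfolding well_energy_def
  using member_le_sum[of i UNIV "\<lambda>i. 1/4 * ((y $ i)\<^sup>2 - 1)\<^sup>2"] by simp

text \<open>Minimize over the closed cube of half-width 1/2 about \<open>v\<close>, where all signs
  agree with those of \<open>v\<close>. A minimizer on a face would pay more for its well than the
  perturbation can give back compared with \<open>v\<close>, so the minimizer is interior.\<close>

lemma well_energy_local_min:
  fixes S :: "real ^ 'n ^ 'n"
  assumes \<epsilon>: "\<epsilon> \<ge> 0" "16 * (\<epsilon> * abs_sum S) \<le> 1" and v: "v \<in> sign_vectors"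
  shows "\<exists>y. is_local_min (well_energy \<epsilon> S) y \<and> sgn_vec y = v"
proof -
  let ?h = "(\<chi> i. 1/2) :: real ^ 'n"
  have cont: "continuous_on (cbox (v - ?h) (v + ?h)) (well_energy \<epsilon> S)"
    unfolding well_energy_def[abs_def] ising_energy_def
    by (intro continuous_intros matrix_vector_mult_linear_continuous_on)
  have v_mem: "v \<in> cbox (v - ?h) (v + ?h)"
    by (simp add: mem_box_cart)
  then obtain y where y: "y \<in> cbox (v - ?h) (v + ?h)"
    and min: "\<And>z. z \<in> cbox (v - ?h) (v + ?h) \<Longrightarrow> well_energy \<epsilon> S y \<le> well_energy \<epsilon> S z"
    using continuous_attains_inf[OF compact_cbox _ cont] by blast
  have dist: "v $ i - 1/2 \<le> y $ i" "y $ i \<le> v $ i + 1/2" for i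
    using y by (auto simp: mem_box_cart)
  have energy: "\<epsilon> * \<bar>ising_energy S z\<bar> \<le> \<epsilon> * abs_sum S * A\<^sup>2 / 2"
    if "\<And>i. \<bar>z $ i\<bar> \<le> A" for z A
    using mult_left_mono[OF ising_energy_bound[of z A S, OF that] \<epsilon>(1)] by simp
  have interior: "v $ i - 1/2 < y $ i \<and> y $ i < v $ i + 1/2" for i
  proof (rule ccontr)
    assume "\<not> ?thesis"
    \<comment> \<open>A face coordinate has absolute value 1/2 or 3/2; the cheaper case 1/2 still
      costs 9/64.\<close>
    then have "y $ i \<in> {- 3/2, - 1/2, 1/2, 3/2}"
      using dist[of i] sign_vector_nth(1)[OF v, of i] by auto
    moreover have "\<forall>u\<in>{- 3/2, - 1/2, 1/2, 3/2 :: real}. (u\<^sup>2 - 1)\<^sup>2 \<ge> 9/16"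
      by (simp add: power2_eq_square)
    ultimately have "((y $ i)\<^sup>2 - 1)\<^sup>2 \<ge> 9/16" by blast
    then have "well_energy \<epsilon> S y \<ge> 9/64 + \<epsilon> * ising_energy S y"
      using well_energy_ge_coordinate[of y i \<epsilon> S] by linarith
    moreover have "\<bar>y $ j\<bar> \<le> 3/2" for j
      using dist[of j] sign_vector_nth(1)[OF v, of j] by (auto simp: abs_le_iff)
    then have "\<epsilon> * \<bar>ising_energy S y\<bar> \<le> \<epsilon> * abs_sum S * (3/2)\<^sup>2 / 2"
      by (rule energy)
    moreover have "\<epsilon> * \<bar>ising_energy S v\<bar> \<le> \<epsilon> * abs_sum S * 1\<^sup>2 / 2"
      using sign_vector_nth(2)[OF v] by (intro energy) simp
    moreover have "well_energy \<epsilon> S y \<le> \<epsilon> * ising_energy S v"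
      using min[OF v_mem] well_energy_sign_vector[OF v] by simp
    moreover have "\<epsilon> * ising_energy S v \<le> \<epsilon> * \<bar>ising_energy S v\<bar>"
      "- (\<epsilon> * \<bar>ising_energy S y\<bar>) \<le> \<epsilon> * ising_energy S y"
      using mult_left_mono[OF _ \<epsilon>(1), of "- \<bar>ising_energy S y\<bar>" "ising_energy S y"] \<epsilon>(1)
      by (auto intro: mult_left_mono)
    \<comment> \<open>The two energy terms amount to at most (9/8 + 1/2) / 16 = 13/128, which is
      below 9/64.\<close>
    ultimately show False
      using \<epsilon>(2) by (simp add: power2_eq_square)
  qed
  then have "y \<in> box (v - ?h) (v + ?h)"
    by (simp add: mem_box_cart)
  then obtain e where "e > 0" "ball y e \<subseteq> box (v - ?h) (v + ?h)"
    using open_box openE by blast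
  then have "is_local_min (well_energy \<epsilon> S) y"
    unfolding is_local_min_def using min box_subset_cbox by blast
  moreover have "sgn (y $ i) = v $ i" for i
    using sign_vector_nth(1)[OF v, of i] dist[of i] by (auto simp: sgn_if)
  then have "sgn_vec y = v"
    by (simp add: sgn_vec_def vec_eq_iff)
  ultimately show ?thesis by blast
qed

lemma is_local_min_if_scaleR:
  fixes f g :: "'a::real_normed_vector \<Rightarrow> real"
  assumes r: "r > 0" and fg: "\<And>x y. f x \<le> f y \<Longrightarrow> g (r *\<^sub>R x) \<le> g (r *\<^sub>R y)"
    and f: "is_local_min f y"
  shows "is_local_min g (r *\<^sub>R y)"
proof -
  obtain e where e: "e > 0" "\<And>z. dist y z < e \<Longrightarrow> f y \<le> f z"
    using f by (auto simp: is_local_min_def)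
  have "g (r *\<^sub>R y) \<le> g z" if "dist (r *\<^sub>R y) z < r * e" for z
  proof -
    have "r *\<^sub>R y - z = r *\<^sub>R (y - (1 / r) *\<^sub>R z)"
      using r by (simp add: scaleR_diff_right)
    then have "dist (r *\<^sub>R y) z = r * dist y ((1 / r) *\<^sub>R z)"
      using r by (simp add: dist_norm)
    then have "dist y ((1 / r) *\<^sub>R z) < e"
      using r that by simp
    then show ?thesis
      using fg[OF e(2)] r by fastforce
  qed
  then show ?thesis
    unfolding is_local_min_def using r e(1) by (intro exI[of _ "r * e"]) auto
qed

text \<open>Moving by t along the axis of a vanishing coordinate changes the potential by t^4/4 - a
  t^2/2 plus a linear term. With the right sign of t and t^2 at most a, this is a strict
  decrease.\<close>

lemma cim_U_local_min_nonzero: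
  fixes S :: "real ^ 'n ^ 'n"
  assumes diag: "S $ i $ i = 0" and \<alpha>: "\<alpha>\<^sup>2 > \<beta>"
    and "is_local_min (cim_U \<beta> S \<alpha>) x"
  shows "x $ i \<noteq> 0"
proof
  assume xi: "x $ i = 0"
  obtain e where e: "e > 0" "\<And>y. dist x y < e \<Longrightarrow> cim_U \<beta> S \<alpha> x \<le> cim_U \<beta> S \<alpha> y"
    using assms(3) by (auto simp: is_local_min_def)
  define a where "a = \<alpha>\<^sup>2 - \<beta>"
  have a: "a > 0" using \<alpha> by (simp add: a_def)
  define h where "h = x \<bullet> (S *v axis i 1) + axis i 1 \<bullet> (S *v x)"
  \<comment> \<open>The zero diagonal is what keeps \<open>S\<close> from contributing to the
    coefficient of t^2.\<close>
  have diag': "axis i 1 \<bullet> (S *v axis i 1) = 0"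
    by (simp add: inner_axis' matrix_vector_mult_basis column_def diag)
  have expand: "cim_U \<beta> S \<alpha> (x + t *\<^sub>R axis i 1) = cim_U \<beta> S \<alpha> x + t^4 / 4 - a / 2 * t\<^sup>2 - t * h / 2"
    for t
  proof -
    have "(\<Sum>j\<in>UNIV. 1/4 * ((x + t *\<^sub>R axis i 1) $ j)^4)
        = (\<Sum>j\<in>UNIV. 1/4 * (x $ j)^4 + (if j = i then t^4 / 4 else 0))"
      by (intro sum.cong) (auto simp: axis_def xi)
    also have "\<dots> = (\<Sum>j\<in>UNIV. 1/4 * (x $ j)^4) + t^4 / 4"
      by (simp add: sum.distrib)
    finally have quartic: "(\<Sum>j\<in>UNIV. 1/4 * ((x + t *\<^sub>R axis i 1) $ j)^4)
        = (\<Sum>j\<in>UNIV. 1/4 * (x $ j)^4) + t^4 / 4" .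
    have square: "(x + t *\<^sub>R axis i 1) \<bullet> (x + t *\<^sub>R axis i 1) = x \<bullet> x + t\<^sup>2"
      by (simp add: inner_add_left inner_add_right inner_axis_axis inner_axis inner_axis' xi power2_eq_square)
    have quad: "(x + t *\<^sub>R axis i 1) \<bullet> (S *v (x + t *\<^sub>R axis i 1)) = x \<bullet> (S *v x) + t * h"
      by (simp add: h_def matrix_vector_right_distrib matrix_vector_mult_scaleR inner_add_left
          inner_add_right diag' algebra_simps)
    show ?thesis
      unfolding cim_U_def quartic square quad a_def by (simp add: field_simps)
  qed
  \<comment> \<open>The bound \<open>e / 2\<close> keeps the step inside the ball;
    \<open>sqrt a\<close> makes the quartic term at most half of the quadratic one.\<close>
  define s where "s = min (e / 2) (sqrt a)"
  have s: "0 < s" "s < e" "s\<^sup>2 \<le> a"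
    using e(1) a power_mono[of s "sqrt a" 2] by (auto simp: s_def)
  \<comment> \<open>the linear term \<open>- t h / 2\<close> is nonpositive for this choice of the sign of \<open>t\<close>\<close>
  define t where "t = (if h \<ge> 0 then s else - s)"
  have t: "t\<^sup>2 = s\<^sup>2" "t^4 = s^4" "t * h \<ge> 0" "\<bar>t\<bar> = s"
    using s(1) by (auto simp: t_def mult_le_0_iff)
  have "dist x (x + t *\<^sub>R axis i 1) < e"
    using s t(4) by (simp add: dist_norm norm_axis_1)
  then have "0 \<le> s^4 / 4 - a / 2 * s\<^sup>2 - t * h / 2"
    using e(2)[of "x + t *\<^sub>R axis i 1"] expand[of t] t(1,2) by simp
  moreover have "s^4 \<le> a * s\<^sup>2"
    using mult_right_mono[OF s(3), of "s\<^sup>2"] by (simp add: power4_eq_xxxx power2_eq_square mult_ac)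
  moreover have "a * s\<^sup>2 > 0" using a s(1) by simp
  ultimately show False using t(3) by linarith
qed

section \<open>Lower bound within an orthant\<close>

text \<open>Let m be the largest deviation of a coordinate from its sign. Its well alone costs at
  least m^2/4, while passing from the signs to \<open>y\<close> lowers the weighted energy by at
  most b m + b m^2/2. Optimizing over m leaves a loss of second order in b.\<close>

lemma well_energy_lower_bound:
  fixes S :: "real ^ 'n ^ 'n"
  assumes \<epsilon>: "\<epsilon> \<ge> 0" "4 * (\<epsilon> * abs_sum S) \<le> 1" and v: "sgn_vec y \<in> sign_vectors"
  shows "well_energy \<epsilon> S y \<ge> \<epsilon> * ising_energy S (sgn_vec y) - 2 * (\<epsilon> * abs_sum S)\<^sup>2"
proof -
  define v where "v = sgn_vec y"
  define b where "b = \<epsilon> * abs_sum S"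
  define m where "m = Max (range (\<lambda>i. \<bar>y $ i - v $ i\<bar>))"
  have m: "\<bar>y $ i - v $ i\<bar> \<le> m" for i
    unfolding m_def by (intro Max_ge) auto
  have "m \<in> range (\<lambda>i. \<bar>y $ i - v $ i\<bar>)"
    unfolding m_def by (intro Max_in) auto
  then obtain k where k: "m = \<bar>y $ k - v $ k\<bar>" by auto
  have "y $ k \<noteq> 0"
    using v by (simp add: sgn_vec_in_sign_vectors_iff)
  then have mk: "m\<^sup>2 = (\<bar>y $ k\<bar> - 1)\<^sup>2"
    by (auto simp: k v_def sgn_vec_def sgn_if power2_eq_square algebra_simps)
  \<comment> \<open>The well factors through \<bar>y_k\<bar> - 1, which is m up to sign, and
    \<bar>y_k\<bar> + 1, which is at least 1.\<close>
  have "m\<^sup>2 * 1 \<le> m\<^sup>2 * (\<bar>y $ k\<bar> + 1)\<^sup>2"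
    by (intro mult_left_mono) auto
  also have "\<dots> = ((\<bar>y $ k\<bar> - 1) * (\<bar>y $ k\<bar> + 1))\<^sup>2"
    by (simp add: mk power_mult_distrib)
  also have "(\<bar>y $ k\<bar> - 1) * (\<bar>y $ k\<bar> + 1) = (y $ k)\<^sup>2 - 1"
    by (simp add: algebra_simps power2_eq_square flip: abs_mult)
  finally have "well_energy \<epsilon> S y \<ge> m\<^sup>2 / 4 + \<epsilon> * ising_energy S y"
    using well_energy_ge_coordinate[of y k \<epsilon> S] by linarith
  moreover have "\<bar>ising_energy S y - ising_energy S v\<bar> \<le> abs_sum S * (2 * m + m\<^sup>2) / 2"
    using v m by (intro ising_energy_diff) (simp_all add: v_def)
  then have "\<epsilon> * (ising_energy S v - ising_energy S y) \<le> \<epsilon> * (abs_sum S * (2 * m + m\<^sup>2) / 2)"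
    using \<epsilon>(1) by (intro mult_left_mono) linarith+
  then have "\<epsilon> * ising_energy S v - \<epsilon> * ising_energy S y \<le> b * m + b * m\<^sup>2 / 2"
    by (simp add: b_def algebra_simps)
  moreover have "4 * b * m\<^sup>2 \<le> 1 * m\<^sup>2"
    using \<epsilon>(2) by (intro mult_right_mono) (auto simp: b_def)
  \<comment> \<open>This square gives b m \<le> m^2/8 + 2 b^2. Together with b m^2/2 \<le> m^2/8 it
    uses up exactly the well cost m^2/4.\<close>
  moreover have "0 \<le> (m - 4 * b)\<^sup>2" by simp
  then have "8 * (b * m) \<le> m\<^sup>2 + 16 * b\<^sup>2"
    by (simp add: power2_eq_square algebra_simps)
  ultimately show ?thesis
    unfolding v_def[symmetric] b_def[symmetric] by linarith
qed

section \<open>Existence of an admissible threshold\<close>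

theorem admissible_threshold_exists:
  fixes S :: "real ^ 'n ^ 'n"
  assumes diag: "\<And>i. S $ i $ i = 0"
  shows "\<exists>\<alpha>\<^sub>0. admissible_threshold \<beta> S \<alpha>\<^sub>0"
proof -
  obtain g where g: "g > 0" and gap: "\<And>v w. v \<in> sign_vectors \<Longrightarrow> w \<in> sign_vectors \<Longrightarrow>
      ising_energy S v < ising_energy S w \<Longrightarrow> ising_energy S v + g \<le> ising_energy S w"
    using finite_gap[OF finite_sign_vectors] by metis
  define M where "M = abs_sum S"
  have M: "M \<ge> 0" by (simp add: M_def abs_sum_nonneg)
  \<comment> \<open>The part \<open>1 + \<bar>\<beta>\<bar>\<close> gives \<alpha>^2 - \<beta> \<ge>
    \<alpha>, so a inherits the other bounds: \<open>16 * M\<close> makes the perturbation weak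
    enough for local minima, and the last term makes the loss 2 (M/a)^2 smaller than the scaled gap
    g/a.\<close>
  define \<alpha>\<^sub>0 where "\<alpha>\<^sub>0 = 1 + \<bar>\<beta>\<bar> + 16 * M + 2 * M\<^sup>2 / g"
  have pos: "2 * M\<^sup>2 / g \<ge> 0" using g by simp
  have "admissible_threshold \<beta> S \<alpha>\<^sub>0"
    unfolding admissible_threshold_def
  proof (intro conjI allI impI)
    show "\<alpha>\<^sub>0 > 0" unfolding \<alpha>\<^sub>0_def using M pos by linarith
    fix \<alpha> assume \<alpha>: "\<alpha> > \<alpha>\<^sub>0"
    define a where "a = \<alpha>\<^sup>2 - \<beta>"
    have "\<alpha> * (1 + \<bar>\<beta>\<bar>) \<le> \<alpha> * \<alpha>"
      using \<alpha> M pos unfolding \<alpha>\<^sub>0_def by (intro mult_left_mono) linarith+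
    moreover have "1 * \<bar>\<beta>\<bar> \<le> \<alpha> * \<bar>\<beta>\<bar>"
      using \<alpha> M pos unfolding \<alpha>\<^sub>0_def by (intro mult_right_mono) linarith+
    ultimately have "a \<ge> \<alpha>"
      by (simp add: a_def power2_eq_square algebra_simps)
    then have a: "a > 0" "a > 16 * M" "a > 2 * M\<^sup>2 / g"
      using \<alpha> M pos unfolding \<alpha>\<^sub>0_def by linarith+
    have \<epsilon>: "1 / a \<ge> 0" "16 * (1 / a * abs_sum S) \<le> 1"
      using a by (auto simp: M_def)
    have scale: "cim_U \<beta> S \<alpha> (sqrt a *\<^sub>R y) \<le> cim_U \<beta> S \<alpha> (sqrt a *\<^sub>R z)
        \<longleftrightarrow> well_energy (1 / a) S y \<le> well_energy (1 / a) S z" for y z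
      using a(1) by (simp add: cim_U_scaleR[OF a_def[symmetric]])
    have sgn_local: "sgn_vec x \<in> sign_vectors" if "is_local_min (cim_U \<beta> S \<alpha>) x" for x
      using cim_U_local_min_nonzero[OF diag _ that] a(1) by (simp add: sgn_vec_in_sign_vectors_iff a_def)
    show "sgn_vec ` {x. is_local_min (cim_U \<beta> S \<alpha>) x} = sign_vectors"
    proof (intro antisym subsetI)
      fix v :: "real ^ 'n" assume "v \<in> sign_vectors"
      then obtain y where y: "is_local_min (well_energy (1 / a) S) y" "sgn_vec y = v"
        using well_energy_local_min[OF \<epsilon>] by blast
      have "is_local_min (cim_U \<beta> S \<alpha>) (sqrt a *\<^sub>R y)"
        by (rule is_local_min_if_scaleR[OF _ _ y(1)]) (use a(1) scale in auto)
      moreover have "sgn_vec (sqrt a *\<^sub>R y) = v"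
        using y(2) a(1) by (simp add: sgn_vec_scaleR)
      ultimately show "v \<in> sgn_vec ` {x. is_local_min (cim_U \<beta> S \<alpha>) x}" by blast
    qed (use sgn_local in auto)
    show "is_arg_min (ising_energy S) (\<lambda>v. v \<in> sign_vectors) (sgn_vec x)"
      if x: "is_global_min (cim_U \<beta> S \<alpha>) x" for x
    proof -
      have min: "cim_U \<beta> S \<alpha> x \<le> cim_U \<beta> S \<alpha> z" for z
        using x by (simp add: is_global_min_def is_arg_min_linorder)
      then have sgn_x: "sgn_vec x \<in> sign_vectors"
        by (intro sgn_local) (auto simp: is_local_min_def intro: exI[of _ 1])
      define y where "y = (1 / sqrt a) *\<^sub>R x"
      have xy: "x = sqrt a *\<^sub>R y" using a(1) by (simp add: y_def)
      have sgn_y: "sgn_vec y = sgn_vec x"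
        using a(1) by (simp add: xy sgn_vec_scaleR)
      have "ising_energy S (sgn_vec x) \<le> ising_energy S w" if w: "w \<in> sign_vectors" for w
      proof (rule ccontr)
        assume "\<not> ?thesis"
        then have "ising_energy S w + g \<le> ising_energy S (sgn_vec x)"
          using gap[OF w sgn_x] by simp
        then have "1 / a * (ising_energy S w + g) \<le> 1 / a * ising_energy S (sgn_vec x)"
          using a(1) by (intro mult_left_mono) auto
        moreover have "1 / a * ising_energy S (sgn_vec x) - 2 * (1 / a * M)\<^sup>2 \<le> well_energy (1 / a) S y"
          using well_energy_lower_bound[OF \<epsilon>(1), of S y] \<epsilon>(2) sgn_x a(1) M
          by (simp add: sgn_y M_def)
        \<comment> \<open>The competitor is the scaled sign vector \<open>w\<close>: it sits at the
          bottom of every well, so only its energy remains.\<close>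
        moreover have "well_energy (1 / a) S y \<le> 1 / a * ising_energy S w"
          using min[of "sqrt a *\<^sub>R w"] scale by (simp add: xy well_energy_sign_vector[OF w])
        ultimately have "1 / a * g \<le> 2 * (1 / a * M)\<^sup>2"
          by (simp add: distrib_left add_divide_distrib)
        then have "a * g \<le> 2 * M\<^sup>2"
          using a(1) by (simp add: field_simps power2_eq_square)
        then show False using a(3) g by (simp add: field_simps)
      qed
      then show ?thesis
        using sgn_x by (simp add: is_arg_min_linorder)
    qed
  qed
  then show ?thesis by blast
qed

section \<open>Restriction of the coherent Ising machine to s = 0\<close>

lemma cim_U_d_real_axis:
  assumes "p \<ge> 0"
  shows "cim_U_d \<Xi> p (c, 0) = cim_U 1 \<Xi> (sqrt p) c"
proof -
  have "(\<Sum>j\<in>UNIV. 1/4 * ((c $ j)\<^sup>2)\<^sup>2 - p/2 * (c $ j)\<^sup>2 + 1/2 * (c $ j)\<^sup>2)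
      = (\<Sum>j\<in>UNIV. 1/4 * (c $ j)^4) + (1 - p) / 2 * (c \<bullet> c)"
    unfolding inner_vec_def sum_distrib_left sum.distrib[symmetric]
    by (intro sum.cong) (simp_all add: field_simps power2_eq_square power4_eq_xxxx)
  then show ?thesis
    using assms by (simp add: cim_U_d_def cim_U_def)
qed

theorem proposition3p2:
  fixes \<Xi> :: "real ^ 'n ^ 'n"
  assumes "transpose \<Xi> = \<Xi>"
    and "\<forall>i. \<Xi> $ i $ i = 0"
  shows "\<exists>\<alpha>\<^sub>0. admissible_threshold 1 \<Xi> \<alpha>\<^sub>0 \<and>
    (\<forall>p>1. p > max (\<alpha>\<^sub>0\<^sup>2) (largest_eigenvalue \<Xi>) \<longrightarrow>
      (\<forall>c. is_global_min (cim_U_d \<Xi> p) (c, 0) \<longrightarrow>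
           is_arg_min (ising_energy \<Xi>) (\<lambda>v. v \<in> sign_vectors) (sgn_vec c)))"
proof -
  obtain \<alpha>\<^sub>0 where adm: "admissible_threshold 1 \<Xi> \<alpha>\<^sub>0"
    using admissible_threshold_exists assms(2) by blast
  have "is_arg_min (ising_energy \<Xi>) (\<lambda>v. v \<in> sign_vectors) (sgn_vec c)"
    if p: "p > 1" "p > max (\<alpha>\<^sub>0\<^sup>2) (largest_eigenvalue \<Xi>)"
      and c: "is_global_min (cim_U_d \<Xi> p) (c, 0)" for p c
  proof -
    have "sqrt p > \<alpha>\<^sub>0"
      using p(2) by (simp add: real_less_rsqrt)
    \<comment> \<open>A global minimum at (c, 0) is in particular minimal among the points (z,
      0).\<close>
    moreover have "is_global_min (cim_U 1 \<Xi> (sqrt p)) c"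
      using c p(1) by (auto simp: is_global_min_def is_arg_min_linorder simp flip: cim_U_d_real_axis)
    ultimately show ?thesis
      using adm by (simp add: admissible_threshold_def)
  qed
  with adm show ?thesis by blast
qed

end
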